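(* Let $q_1=(x_1,y_1,z_1)\in J^+(q_0)\setminus I^+(q_0)$, $q_1\ne q_0$. Then an optimal trajectory connecting $q_0$ with $q_1$ in the full sub-Lorentzian problem \begin{align*} &\dot q=u_1X_1(q)+u_2X_2(q),\qquad q\in M,\\ &(u_1,u_2)\in U=\{(u_1,u_2)\in\mathbb R^2\mid u_1\ge|u_2|\},\\ &q(0)=q_0,\qquad q(t_1)=q_1,\\ &l(q(\cdot))=\int_0^{t_1}\sqrt{u_1^2-u_2^2}\,dt\to\max \end{align*} is a future directed lightlike piecewise smooth trajectory with one or two subarcs generated by the vector fields $X_1\pm X_2$. In detail, up to a reparametrization: (1) If $z_1=0$, then $u(t)\equiv\mathrm{const}=(1,\pm1)$, $q(t)=(t,\pm t,0)$, $t\in[0,t_1]$, $t_1=x_1$. (2) If $z_1>0$, then with $\tau_1=\frac{x_1-y_1}{2}$, $\tau_2=\frac{x_1+y_1}{2}$: \begin{align*} &t\in[0,\tau_1]\ \Rightarrow\ u(t)\equiv(1,-1),\quad q(t)=(t,-t,0),\\ &t\in[\tau_1,\tau_1+\tau_2]\ \Rightarrow\ u(t)\equiv(1,1),\quad q(t)=(t,\,t-2\tau_1,\,\tau_1(t-\tau_1)). \end{align*} (3) If $z_1<0$, then with $\tau_1=\frac{x_1+y_1}{2}$, $\tau_2=\frac{x_1-y_1}{2}$: \begin{align*} &t\in[0,\tau_1]\ \Rightarrow\ u(t)\equiv(1,1),\quad q(t)=(t,t,0),\\ &t\in[\tau_1,\tau_1+\tau_2]\ \Rightarrow\ u(t)\equiv(1,-1),\quad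 q(t)=(t,\,2\tau_1-t,\,-\tau_1(t-\tau_1)). \end{align*}
   Context: $M=\mathbb R^3_{x,y,z}$ is the Heisenberg group with product $(x_1,y_1,z_1)\cdot(x_2,y_2,z_2)=(x_1+x_2,\,y_1+y_2,\,z_1+z_2+(x_1y_2-x_2y_1)/2)$, $q_0=(0,0,0)$, $X_1=\frac{\partial}{\partial x}-\frac y2\frac{\partial}{\partial z}$, $X_2=\frac{\partial}{\partial y}+\frac x2\frac{\partial}{\partial z}$. Trajectories are Lipschitz curves satisfying the control system for a.e. $t$; the terminal time is free. A trajectory is future directed lightlike if its control satisfies $u_1=|u_2|>0$ a.e. A reparametrization of $q(t)$, $t\in[0,t_1]$, is a curve $q(t(s))$ with $t(\cdot)$ monotone nondecreasing Lipschitz from some $[0,s_1]$ onto $[0,t_1]$. The causal future $J^+(q_0)$ is the set of points reachable from $q_0$ (in nonnegative time) with controls in $U$, and the chronological future $I^+(q_0)$ is the set of points reachable in positive time with $u_1>|u_2|$. It is known that $J^+(q_0)=\{-x^2+y^2+4|z|\le0,\ x\ge0\}$ and $I^+(q_0)=\{-x^2+y^2+4|z|<0,\ x>0\}$; the set $J^+(q_0)\setminus I^+(q_0)$ is the boundary $\partial\mathcal A$ of $\mathcal A=I^+(q_0)\cup\{q_0\}$. In item (1) the sign $\pm$ is the one for which $y_1=\pm x_1$. *)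

theory Defs
  imports "HOL-Analysis.Analysis"
begin

type_synonym point = "real \<times> real \<times> real"
type_synonym control = "real \<times> real"

definition X1 :: "point \<Rightarrow> point" where
  "X1 = (\<lambda>(x, y, z). (1, 0, - y / 2))"

definition X2 :: "point \<Rightarrow> point" where
  "X2 = (\<lambda>(x, y, z). (0, 1, x / 2))"

definition causal_controls :: "control set" where
  "causal_controls = {(u1, u2). u1 \<ge> \<bar>u2\<bar>}"

definition timelike_controls :: "control set" where
  "timelike_controls = {(u1, u2). u1 > \<bar>u2\<bar>}"

definition lightlike_controls :: "control set" where
  "lightlike_controls = {(u1, u2). u1 = \<bar>u2\<bar> \<and> \<bar>u2\<bar> > 0}"

text \<open>
  A trajectory is given by its control \<open>u\<close>, its curve \<open>q\<close> and its terminal time \<open>T\<close>; the values of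
  \<open>u\<close> and \<open>q\<close> outside \<open>{0..T}\<close> are irrelevant. The control is determined almost everywhere by the
  curve, and it is essentially bounded because the curve is Lipschitz.
\<close>

definition trajectory ::
    "control set \<Rightarrow> (real \<Rightarrow> control) \<Rightarrow> (real \<Rightarrow> point) \<Rightarrow> real \<Rightarrow> bool" where
  "trajectory U u q T \<longleftrightarrow>
     0 \<le> T \<and>
     (\<exists>L. L-lipschitz_on {0..T} q) \<and>
     u \<in> borel_measurable (lebesgue_on {0..T}) \<and>
     (AE t in lebesgue_on {0..T}.
        u t \<in> U \<and>
        (q has_vector_derivative fst (u t) *\<^sub>R X1 (q t) + snd (u t) *\<^sub>R X2 (q t))
          (at t within {0..T}))"

definition causal_future :: "point \<Rightarrow> point set" where
  "causal_future p = {p'. \<exists>u q T. trajectory causal_controls u q T \<and> q 0 = p \<and> q T = p'}"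

definition chronological_future :: "point \<Rightarrow> point set" where
  "chronological_future p =
     {p'. \<exists>u q T. T > 0 \<and> trajectory timelike_controls u q T \<and> q 0 = p \<and> q T = p'}"

definition sl_length :: "(real \<Rightarrow> control) \<Rightarrow> real \<Rightarrow> real" where
  "sl_length u T = (LINT t|lebesgue_on {0..T}. sqrt ((fst (u t))\<^sup>2 - (snd (u t))\<^sup>2))"

definition optimal ::
    "point \<Rightarrow> point \<Rightarrow> (real \<Rightarrow> control) \<Rightarrow> (real \<Rightarrow> point) \<Rightarrow> real \<Rightarrow> bool" where
  "optimal p p' u q T \<longleftrightarrow>
     trajectory causal_controls u q T \<and> q 0 = p \<and> q T = p' \<and>
     (\<forall>v r S. trajectory causal_controls v r S \<and> r 0 = p \<and> r S = p' \<longrightarrow>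
        sl_length v S \<le> sl_length u T)"

text \<open>\<open>reparametrization q T r S\<close>: the curve \<open>r\<close> on \<open>{0..S}\<close> is a reparametrization of \<open>q\<close> on
  \<open>{0..T}\<close>. The change of parameter need not be injective, so \<open>r\<close> may stand still where \<open>q\<close> does not.\<close>

definition reparametrization ::
    "(real \<Rightarrow> point) \<Rightarrow> real \<Rightarrow> (real \<Rightarrow> point) \<Rightarrow> real \<Rightarrow> bool" where
  "reparametrization q T r S \<longleftrightarrow>
     0 \<le> S \<and>
     (\<exists>\<theta>. mono_on {0..S} \<theta> \<and> (\<exists>L. L-lipschitz_on {0..S} \<theta>) \<and> \<theta> ` {0..S} = {0..T} \<and>
        (\<forall>s\<in>{0..S}. r s = q (\<theta> s)))"

text \<open>\<open>D n\<close> is the \<open>n\<close>-th derivative, one-sided at the end points of an interval.\<close>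

definition smooth_curve_on :: "real set \<Rightarrow> (real \<Rightarrow> point) \<Rightarrow> bool" where
  "smooth_curve_on I q \<longleftrightarrow>
     (\<exists>D. (\<forall>t\<in>I. D 0 t = q t) \<and>
        (\<forall>n. \<forall>t\<in>I. (D n has_vector_derivative D (Suc n) t) (at t within I)))"

definition generated_by :: "(point \<Rightarrow> point) \<Rightarrow> (real \<Rightarrow> point) \<Rightarrow> real set \<Rightarrow> bool" where
  "generated_by X q I \<longleftrightarrow> (\<forall>t\<in>I. (q has_vector_derivative X (q t)) (at t within I))"

text \<open>The curve consists of exactly \<open>n\<close> nontrivial smooth arcs between the break points \<open>s i\<close>,
  alternately generated by \<open>X1 + X2\<close> and \<open>X1 - X2\<close>, in either order.\<close>

definition lightlike_subarcs :: "nat \<Rightarrow> (real \<Rightarrow> point) \<Rightarrow> real \<Rightarrow> bool" where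
  "lightlike_subarcs n q T \<longleftrightarrow>
     (\<exists>(s :: nat \<Rightarrow> real) (\<sigma> :: nat \<Rightarrow> real).
        s 0 = 0 \<and> s n = T \<and>
        (\<forall>i<n. s i < s (Suc i) \<and> \<sigma> i \<in> {1, -1} \<and>
           smooth_curve_on {s i..s (Suc i)} q \<and>
           generated_by (\<lambda>p. X1 p + \<sigma> i *\<^sub>R X2 p) q {s i..s (Suc i)}) \<and>
        (\<forall>i. Suc i < n \<longrightarrow> \<sigma> (Suc i) = - \<sigma> i))"

end

theory Submission
  imports Defs
begin

text \<open>For a sign \<open>\<sigma>\<close> use the null coordinates \<open>a = (x + \<sigma> y)/2\<close> and \<open>b = (x - \<sigma> y)/2\<close>. Along a
  causal trajectory both are nondecreasing and the slack \<open>a b - \<sigma> z\<close> has derivative \<open>2 a b' \<ge> 0\<close>.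
  A point of the causal future with \<open>a, b > 0\<close> and positive slack for both signs is reached by a
  polynomial timelike curve, so an achronal end point has slack zero for one sign. Then the slack
  vanishes along every causal trajectory to it, that is \<open>a b' = 0\<close>: first only \<open>b\<close> grows, then only
  \<open>a\<close>. Hence all these trajectories have length zero, and, parametrized by \<open>x = a + b\<close>, they trace
  one and the same broken line.\<close>

section \<open>Lipschitz functions on an interval: monotonicity and products\<close>

text \<open>If \<open>f r > f s\<close>, then \<open>g t = f t + e t\<close> still decreases from \<open>r\<close> to \<open>s\<close> for small \<open>e > 0\<close>, and has
  positive derivative off a null set. Lipschitz maps preserve null sets, so some intermediate value
  \<open>y\<close> is not attained on that set; at its last crossing \<open>g' > 0\<close> is impossible.\<close>

lemma lipschitz_AE_mono_on:
  fixes f f' :: "real \<Rightarrow> real"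
  assumes lip: "L-lipschitz_on {a..b} f"
    and ae: "AE t in lebesgue_on {a..b}.
      (f has_real_derivative f' t) (at t within {a..b}) \<and> 0 \<le> f' t"
  shows "mono_on {a..b} f"
proof (rule mono_onI, rule ccontr)
  fix r s assume r: "r \<in> {a..b}" and s: "s \<in> {a..b}" and "r \<le> s" "\<not> f r \<le> f s"
  then have rs: "r < s" "f s < f r" by (auto simp: order_less_le)
  \<comment> \<open>The tilt uses up half of the drop \<open>f r - f s\<close>, so \<open>g\<close>
    still decreases from \<open>r\<close> to \<open>s\<close>.\<close>
  define e where "e = (f r - f s) / 2 / (s - r)"
  have e: "e > 0" using rs by (simp add: e_def)
  have "e * (s - r) = (f r - f s) / 2"
    using rs nonzero_eq_divide_eq[of "s - r" e "(f r - f s) / 2"] by (simp only: e_def) simp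
  then have es: "e * (s - r) < f r - f s" using rs by simp
  define g where "g = (\<lambda>t. f t + e * t)"
  have lipg: "(L + \<bar>e\<bar> * 1)-lipschitz_on {a..b} g"
    unfolding g_def by (rule lipschitz_on_add[OF lip lipschitz_on_cmult_real[OF lipschitz_on_id]])
  have contg: "continuous_on {r..s} g"
    using lipschitz_on_continuous_on[OF lipg] r s by (auto elim!: continuous_on_subset)
  obtain N where N: "N \<in> null_sets lebesgue" and
    der: "\<And>t. t \<in> {a..b} - N \<Longrightarrow> (f has_real_derivative f' t) (at t within {a..b}) \<and> 0 \<le> f' t"
    using ae by (subst (asm) AE_restrict_space_iff) (auto elim!: AE_E3)
  have "negligible (g ` (N \<inter> {a..b}))"
  proof (rule negligible_locally_Lipschitz_image)
    show "negligible (N \<inter> {a..b})"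
      using N negligible_iff_null_sets negligible_Int by blast
    fix x assume "x \<in> N \<inter> {a..b}"
    then show "\<exists>T B. open T \<and> x \<in> T \<and>
        (\<forall>y \<in> N \<inter> {a..b} \<inter> T. norm (g y - g x) \<le> B * norm (y - x))"
      using lipschitz_on_normD[OF lipg] by blast
  qed simp
  moreover have "g s < g r" using es by (simp add: g_def algebra_simps)
  then have "\<not> negligible {g s<..<g r}"
    using negligible_iff_measure[of "{g s<..<g r}"] by simp
  ultimately obtain y where y: "g s < y" "y < g r" "y \<notin> g ` (N \<inter> {a..b})"
    by (metis greaterThanLessThan_iff negligible_subset subsetI)
  define K where "K = {r..s} \<inter> g -` {y}"
  have "closed K"
    unfolding K_def by (intro continuous_closed_preimage contg) auto
  moreover have "bounded K"
    unfolding K_def by (intro bounded_Int) auto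
  ultimately have "compact K"
    by (simp add: compact_eq_bounded_closed)
  moreover have "K \<noteq> {}"
    using IVT2'[of g s y r] y rs contg by (auto simp: K_def)
  ultimately obtain c where c: "c \<in> K" "\<And>t. t \<in> K \<Longrightarrow> t \<le> c"
    using compact_attains_sup[of K] by metis
  have cs: "c < s" "g c = y" "r \<le> c"
    using c(1) y(1) by (auto simp: K_def order_less_le)
  have cN: "c \<in> {a..b} - N"
    using cs y(3) r s by auto
  have "(g has_real_derivative f' c + e) (at c within {a..b})"
    unfolding g_def using der[OF cN] by (auto intro!: derivative_eq_intros)
  moreover have "f' c + e > 0" using der[OF cN] e by simp
  ultimately obtain d where d: "d > 0" "\<And>h. \<lbrakk>h > 0; c + h \<in> {a..b}; h < d\<rbrakk> \<Longrightarrow> g c < g (c + h)"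
    using has_real_derivative_pos_inc_right by blast
  obtain h where "0 < h" "h < min d (s - c)"
    using dense[of 0 "min d (s - c)"] d(1) cs(1) by auto
  then have h: "0 < h" "h < d" "c + h < s" "c + h \<in> {a..b}"
    using cs r s by auto
  \<comment> \<open>Just after \<open>c\<close> the function lies above \<open>y\<close> and at
    \<open>s\<close> below it, so the level \<open>y\<close> is met again, later than the last point
    \<open>c\<close> of \<open>K\<close>.\<close>
  then have "y < g (c + h)" using d(2)[of h] cs(2) by simp
  then obtain t where "c + h \<le> t" "t \<le> s" "g t = y"
    using IVT2'[of g s y "c + h"] y(1) h(1,3) cs(3) continuous_on_subset[OF contg, of "{c + h..s}"]
    by (simp add: less_imp_le) blast
  then have "t \<in> K" using h(1) cs(3) by (simp add: K_def)
  then show False using c(2)[of t] h(1) \<open>c + h \<le> t\<close> by simp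
qed

text \<open>Both factors are bounded on the compact interval, which controls the increments of the
  product. This supplies the Lipschitz hypothesis for \<open>slack\<close>, for powers, and for the
  product in \<open>zero_slack_imp_broken\<close>.\<close>

lemma lipschitz_on_compact_mult:
  fixes f g :: "real \<Rightarrow> real"
  assumes "L-lipschitz_on {a..b} f" "M-lipschitz_on {a..b} g"
  shows "\<exists>K. K-lipschitz_on {a..b} (\<lambda>t. f t * g t)"
proof -
  have "compact (f ` {a..b})" "compact (g ` {a..b})"
    using assms by (auto intro!: compact_continuous_image lipschitz_on_continuous_on)
  then obtain A B where AB: "\<forall>x\<in>f ` {a..b}. norm x \<le> A" "\<forall>x\<in>g ` {a..b}. norm x \<le> B"
    using compact_imp_bounded bounded_iff by metis
  \<comment> \<open>The absolute values keep the Lipschitz constant below nonnegative even for an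
    empty interval.\<close>
  have A: "\<bar>f t\<bar> \<le> \<bar>A\<bar>" and B: "\<bar>g t\<bar> \<le> \<bar>B\<bar>" if "t \<in> {a..b}" for t
    using AB that by force+
  have "(\<bar>A\<bar> * M + \<bar>B\<bar> * L)-lipschitz_on {a..b} (\<lambda>t. f t * g t)"
  proof (rule lipschitz_onI)
    fix x y assume xy: "x \<in> {a..b}" "y \<in> {a..b}"
    have "f x * g x - f y * g y = f x * (g x - g y) + g y * (f x - f y)"
      by (simp add: algebra_simps)
    also have "\<bar>\<dots>\<bar> \<le> \<bar>f x\<bar> * \<bar>g x - g y\<bar> + \<bar>g y\<bar> * \<bar>f x - f y\<bar>"
      by (metis abs_mult abs_triangle_ineq)
    also have "\<dots> \<le> \<bar>A\<bar> * (M * \<bar>x - y\<bar>) + \<bar>B\<bar> * (L * \<bar>x - y\<bar>)"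
      using A[OF xy(1)] B[OF xy(2)] lipschitz_on_normD[OF assms(1) xy] lipschitz_on_normD[OF assms(2) xy]
      by (intro add_mono mult_mono) auto
    finally show "dist (f x * g x) (f y * g y) \<le> (\<bar>A\<bar> * M + \<bar>B\<bar> * L) * dist x y"
      by (simp add: dist_real_def algebra_simps)
  qed (use assms lipschitz_on_nonneg in \<open>auto intro!: add_nonneg_nonneg mult_nonneg_nonneg\<close>)
  then show ?thesis by blast
qed

section \<open>Null coordinates and slack along trajectories\<close>

text \<open>For a sign \<sigma> it grows at unit speed along X1 + \<sigma> X2 and is constant along
  X1 - \<sigma> X2.\<close>

definition null_coord :: "real \<Rightarrow> point \<Rightarrow> real" where
  "null_coord \<sigma> = (\<lambda>(x, y, z). (x + \<sigma> * y) / 2)"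

text \<open>For a sign \<sigma> this is (x^2 - y^2 - 4 \<sigma> z) / 4, so the smaller of the two
  slacks vanishes exactly on the surface x^2 - y^2 = 4 |z|.\<close>

definition slack :: "real \<Rightarrow> point \<Rightarrow> real" where
  "slack \<sigma> p = null_coord \<sigma> p * null_coord (- \<sigma>) p - \<sigma> * snd (snd p)"

text \<open>For a sign \<sigma>, the coefficient of X1 + \<sigma> X2 when u1 X1 + u2 X2 is expanded
  in the two fields X1 + \<sigma> X2 and X1 - \<sigma> X2.\<close>

definition null_control :: "real \<Rightarrow> control \<Rightarrow> real" where
  "null_control \<sigma> = (\<lambda>(u1, u2). (u1 + \<sigma> * u2) / 2)"

lemma null_control_nonneg:
  "w \<in> causal_controls \<Longrightarrow> \<sigma> \<in> {1, -1} \<Longrightarrow> 0 \<le> null_control \<sigma> w"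
  by (auto simp: causal_controls_def null_control_def)

lemma dynamics_components:
  fixes q :: "real \<Rightarrow> point"
  assumes "(q has_vector_derivative fst w *\<^sub>R X1 (q t) + snd w *\<^sub>R X2 (q t)) (at t within S)"
  shows "((\<lambda>t. fst (q t)) has_real_derivative fst w) (at t within S)"
    and "((\<lambda>t. fst (snd (q t))) has_real_derivative snd w) (at t within S)"
    and "((\<lambda>t. snd (snd (q t))) has_real_derivative
          (fst (q t) * snd w - fst (snd (q t)) * fst w) / 2) (at t within S)"
proof -
  note d = assms[THEN bounded_linear.has_vector_derivative[rotated]]
  show "((\<lambda>t. fst (q t)) has_real_derivative fst w) (at t within S)"
    using d[OF bounded_linear_fst]
    by (simp add: has_real_derivative_iff_has_vector_derivative X1_def X2_def split: prod.splits)
  show "((\<lambda>t. fst (snd (q t))) has_real_derivative snd w) (at t within S)"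
    using d[OF bounded_linear_compose[OF bounded_linear_fst bounded_linear_snd]]
    by (simp add: has_real_derivative_iff_has_vector_derivative X1_def X2_def split: prod.splits)
  show "((\<lambda>t. snd (snd (q t))) has_real_derivative
          (fst (q t) * snd w - fst (snd (q t)) * fst w) / 2) (at t within S)"
    using d[OF bounded_linear_compose[OF bounded_linear_snd bounded_linear_snd]]
    by (simp add: has_real_derivative_iff_has_vector_derivative X1_def X2_def diff_divide_distrib
        algebra_simps split: prod.splits)
qed

lemma null_coord_derivative:
  assumes "(q has_vector_derivative fst w *\<^sub>R X1 (q t) + snd w *\<^sub>R X2 (q t)) (at t within S)"
  shows "((\<lambda>t. null_coord \<sigma> (q t)) has_real_derivative null_control \<sigma> w) (at t within S)"
  using dynamics_components(1,2)[OF assms]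
  unfolding null_coord_def null_control_def case_prod_beta
  by (auto intro!: derivative_eq_intros)

text \<open>In null coordinates the equation for z reads \<sigma> z' = a' b - a b'. Subtracting it
  from (a b)' = a' b + a b' leaves 2 a b'.\<close>

lemma slack_derivative:
  assumes "(q has_vector_derivative fst w *\<^sub>R X1 (q t) + snd w *\<^sub>R X2 (q t)) (at t within S)"
    and "\<sigma> \<in> {1, -1}"
  shows "((\<lambda>t. slack \<sigma> (q t)) has_real_derivative
          2 * null_coord \<sigma> (q t) * null_control (- \<sigma>) w) (at t within S)"
proof -
  have "((\<lambda>t. slack \<sigma> (q t)) has_real_derivative
      null_coord \<sigma> (q t) * null_control (- \<sigma>) w + null_control \<sigma> w * null_coord (- \<sigma>) (q t)
        - \<sigma> * ((fst (q t) * snd w - fst (snd (q t)) * fst w) / 2)) (at t within S)"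
    unfolding slack_def
    by (rule DERIV_diff[OF DERIV_mult'[OF null_coord_derivative null_coord_derivative]
          DERIV_cmult[OF dynamics_components(3)]]) (rule assms(1))+
  moreover have "null_coord \<sigma> (q t) * null_control (- \<sigma>) w + null_control \<sigma> w * null_coord (- \<sigma>) (q t)
        - \<sigma> * ((fst (q t) * snd w - fst (snd (q t)) * fst w) / 2)
      = 2 * null_coord \<sigma> (q t) * null_control (- \<sigma>) w"
    using assms(2) by (auto simp: null_coord_def null_control_def case_prod_beta field_simps)
  ultimately show ?thesis by metis
qed

lemma lipschitz_on_bounded_linear_compose:
  assumes "bounded_linear f" "\<exists>L. L-lipschitz_on S q"
  shows "\<exists>L. L-lipschitz_on S (\<lambda>t. f (q t))"
proof -
  obtain L where L: "L-lipschitz_on S q" using assms(2) by blast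
  obtain B where B: "B-lipschitz_on (q ` S) f" using bounded_linear.lipschitz_boundE[OF assms(1)] .
  show ?thesis by (rule exI) (rule lipschitz_on_compose2[OF L B])
qed

lemma trajectory_null_coord_lipschitz:
  assumes "trajectory U u q T"
  shows "\<exists>L. L-lipschitz_on {0..T} (\<lambda>t. null_coord \<sigma> (q t))"
proof -
  have "bounded_linear (null_coord \<sigma>)"
    unfolding null_coord_def case_prod_beta
    by (intro linear_conv_bounded_linear[THEN iffD1] linearI) (simp_all add: field_simps)
  then show ?thesis
    using assms lipschitz_on_bounded_linear_compose[of _ "{0..T}" q] by (simp add: trajectory_def)
qed

lemma trajectory_slack_lipschitz:
  assumes "trajectory U u q T"
  shows "\<exists>L. L-lipschitz_on {0..T} (\<lambda>t. slack \<sigma> (q t))"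
proof -
  have "bounded_linear (\<lambda>p :: point. \<sigma> * snd (snd p))"
    by (intro linear_conv_bounded_linear[THEN iffD1] linearI) (simp_all add: algebra_simps)
  then obtain L where L: "L-lipschitz_on {0..T} (\<lambda>t. \<sigma> * snd (snd (q t)))"
    using assms lipschitz_on_bounded_linear_compose[of _ "{0..T}" q] unfolding trajectory_def by blast
  obtain K where K: "K-lipschitz_on {0..T} (\<lambda>t. null_coord \<sigma> (q t) * null_coord (- \<sigma>) (q t))"
    using trajectory_null_coord_lipschitz[OF assms] lipschitz_on_compact_mult by metis
  show ?thesis
    unfolding slack_def by (rule exI) (rule lipschitz_on_diff[OF K L])
qed

section \<open>Monotonicity along causal trajectories\<close>

lemma causal_null_coord_mono:
  assumes "trajectory causal_controls u q T" "\<sigma> \<in> {1, -1}"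
  shows "mono_on {0..T} (\<lambda>t. null_coord \<sigma> (q t))"
proof -
  obtain L where "L-lipschitz_on {0..T} (\<lambda>t. null_coord \<sigma> (q t))"
    using trajectory_null_coord_lipschitz assms by blast
  moreover have "AE t in lebesgue_on {0..T}.
      ((\<lambda>t. null_coord \<sigma> (q t)) has_real_derivative null_control \<sigma> (u t)) (at t within {0..T}) \<and>
      0 \<le> null_control \<sigma> (u t)"
    using assms(1)[unfolded trajectory_def, THEN conjunct2, THEN conjunct2, THEN conjunct2]
    by eventually_elim (simp add: null_coord_derivative null_control_nonneg assms(2)[simplified])
  ultimately show ?thesis by (rule lipschitz_AE_mono_on)
qed

lemma origin_coords [simp]: "null_coord \<sigma> (0, 0, 0) = 0" "slack \<sigma> (0, 0, 0) = 0"
  by (simp_all add: null_coord_def slack_def)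

lemma causal_null_coord_nonneg:
  assumes "trajectory causal_controls u q T" "\<sigma> \<in> {1, -1}" "q 0 = (0, 0, 0)" "t \<in> {0..T}"
  shows "0 \<le> null_coord \<sigma> (q t)"
  using mono_onD[OF causal_null_coord_mono[OF assms(1,2)], of 0 t] assms(3,4) by simp

lemma causal_slack_mono:
  assumes "trajectory causal_controls u q T" "\<sigma> \<in> {1, -1}" "q 0 = (0, 0, 0)"
  shows "mono_on {0..T} (\<lambda>t. slack \<sigma> (q t))"
proof -
  obtain L where "L-lipschitz_on {0..T} (\<lambda>t. slack \<sigma> (q t))"
    using trajectory_slack_lipschitz assms by blast
  moreover have "AE t in lebesgue_on {0..T}.
      ((\<lambda>t. slack \<sigma> (q t)) has_real_derivative
        2 * null_coord \<sigma> (q t) * null_control (- \<sigma>) (u t)) (at t within {0..T}) \<and>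
      0 \<le> 2 * null_coord \<sigma> (q t) * null_control (- \<sigma>) (u t)"
    using assms(1)[unfolded trajectory_def, THEN conjunct2, THEN conjunct2, THEN conjunct2] AE_space
  proof eventually_elim
    case (elim t)
    then have "0 \<le> null_coord \<sigma> (q t)" "0 \<le> null_control (- \<sigma>) (u t)"
      using causal_null_coord_nonneg[OF assms, of t] null_control_nonneg[of "u t" "- \<sigma>"] assms(2)
      by auto
    then show ?case using slack_derivative[of q "u t" t] elim assms(2) by simp
  qed
  ultimately show ?thesis by (rule lipschitz_AE_mono_on)
qed

lemma causal_slack_nonneg:
  assumes "trajectory causal_controls u q T" "\<sigma> \<in> {1, -1}" "q 0 = (0, 0, 0)" "t \<in> {0..T}"
  shows "0 \<le> slack \<sigma> (q t)"
  using mono_onD[OF causal_slack_mono[OF assms(1-3)], of 0 t] assms(3,4) by simp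

text \<open>Both quantities start at zero and never decrease. Taken for both signs, the bounds place
  the causal future in the set where x >= |y| and x^2 - y^2 >= 4 |z|.\<close>

lemma causal_future_bounds:
  assumes "p \<in> causal_future (0, 0, 0)" "\<sigma> \<in> {1, -1}"
  shows "0 \<le> null_coord \<sigma> p" "0 \<le> slack \<sigma> p"
proof -
  obtain u q T where "trajectory causal_controls u q T" "q 0 = (0, 0, 0)" "q T = p"
    using assms(1) by (auto simp: causal_future_def)
  then show "0 \<le> null_coord \<sigma> p" "0 \<le> slack \<sigma> p"
    using causal_null_coord_nonneg[of u q T \<sigma> T] causal_slack_nonneg[of u q T \<sigma> T] assms(2)
    by (auto simp: trajectory_def)
qed

section \<open>Causal trajectories whose end point has zero slack\<close>

text \<open>Derivatives within a nondegenerate closed interval are unique, also at its end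
  points.\<close>

lemma derivative_of_zero_on_Icc:
  fixes f :: "real \<Rightarrow> real"
  assumes "a < b" "x \<in> {a..b}" "(f has_real_derivative d) (at x within {a..b})"
    and "\<And>s. s \<in> {a..b} \<Longrightarrow> f s = 0"
  shows "d = 0"
proof -
  have "(f has_real_derivative 0) (at x within {a..b})"
    by (rule has_field_derivative_transform_within[of "\<lambda>_. 0" _ _ _ 1]) (use assms in auto)
  then show ?thesis
    using vector_derivative_unique_within_closed_interval[of a b x f d 0] assms(1-3)
    by (simp add: has_real_derivative_iff_has_vector_derivative)
qed

lemma trajectory_AE_null_coord_derivative:
  assumes "trajectory U u q T"
  shows "AE t in lebesgue_on {0..T}. t \<in> {0..T} \<and> u t \<in> U \<and>
      (\<forall>\<sigma>. ((\<lambda>t. null_coord \<sigma> (q t)) has_real_derivative null_control \<sigma> (u t)) (at t within {0..T})) \<and>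
      (\<forall>\<sigma>\<in>{1, -1}. ((\<lambda>t. slack \<sigma> (q t)) has_real_derivative
        2 * null_coord \<sigma> (q t) * null_control (- \<sigma>) (u t)) (at t within {0..T}))"
  using assms[unfolded trajectory_def, THEN conjunct2, THEN conjunct2, THEN conjunct2] AE_space
  by eventually_elim (simp add: null_coord_derivative slack_derivative)

text \<open>The slack is squeezed between zero and its final value.\<close>

lemma zero_slack_propagates:
  assumes "trajectory causal_controls u q T" "\<sigma> \<in> {1, -1}" "q 0 = (0, 0, 0)"
    and "slack \<sigma> (q T) = 0" "t \<in> {0..T}"
  shows "slack \<sigma> (q t) = 0"
  using causal_slack_nonneg[OF assms(1-3,5)] mono_onD[OF causal_slack_mono[OF assms(1-3)], of t T]
    assms(4,5) by simp

lemma zero_slack_AE: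
  assumes tr: "trajectory causal_controls u q T" and \<sigma>: "\<sigma> \<in> {1, -1}" and q0: "q 0 = (0, 0, 0)"
    and end0: "slack \<sigma> (q T) = 0" and T: "0 < T"
  shows "AE t in lebesgue_on {0..T}. null_coord \<sigma> (q t) * null_control (- \<sigma>) (u t) = 0"
  using trajectory_AE_null_coord_derivative[OF tr]
proof eventually_elim
  case (elim t)
  have D: "((\<lambda>t. slack \<sigma> (q t)) has_real_derivative
      2 * null_coord \<sigma> (q t) * null_control (- \<sigma>) (u t)) (at t within {0..T})"
    using elim \<sigma> by blast
  have "2 * null_coord \<sigma> (q t) * null_control (- \<sigma>) (u t) = 0"
    by (rule derivative_of_zero_on_Icc[OF T _ D zero_slack_propagates[OF tr \<sigma> q0 end0]])
      (use elim in auto)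
  then show ?case by simp
qed

text \<open>The product of \<open>a\<close> and \<open>b(T) - b\<close> has derivative \<open>a' (b(T) - b) - a b' \<ge> 0\<close>, as \<open>a b' = 0\<close>,
  and it vanishes at both end points.\<close>

lemma zero_slack_imp_broken:
  assumes tr: "trajectory causal_controls u q T" and \<sigma>: "\<sigma> \<in> {1, -1}" and q0: "q 0 = (0, 0, 0)"
    and end0: "slack \<sigma> (q T) = 0" and t: "t \<in> {0..T}"
  shows "null_coord \<sigma> (q t) = 0 \<or> null_coord (- \<sigma>) (q t) = null_coord (- \<sigma>) (q T)"
proof (cases "T = 0")
  case True
  then show ?thesis using t by simp
next
  case False
  then have T: "0 < T" using t by simp
  define c where "c = null_coord (- \<sigma>) (q T)"
  define f where "f = (\<lambda>t. null_coord \<sigma> (q t) * (c - null_coord (- \<sigma>) (q t)))"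
  have \<sigma>': "- \<sigma> \<in> {1, -1}" using \<sigma> by auto
  obtain M where M: "M-lipschitz_on {0..T} (\<lambda>t. null_coord (- \<sigma>) (q t))"
    using trajectory_null_coord_lipschitz[OF tr] by blast
  obtain N where N: "N-lipschitz_on {0..T} (\<lambda>t. null_coord \<sigma> (q t))"
    using trajectory_null_coord_lipschitz[OF tr] by blast
  obtain K where K: "K-lipschitz_on {0..T} f"
    using lipschitz_on_compact_mult[OF N lipschitz_on_diff[OF lipschitz_on_constant M]]
    unfolding f_def by blast
  have "AE t in lebesgue_on {0..T}.
      (f has_real_derivative null_control \<sigma> (u t) * (c - null_coord (- \<sigma>) (q t))) (at t within {0..T}) \<and>
      0 \<le> null_control \<sigma> (u t) * (c - null_coord (- \<sigma>) (q t))"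
    using trajectory_AE_null_coord_derivative[OF tr] zero_slack_AE[OF tr \<sigma> q0 end0 T]
  proof eventually_elim
    case (elim t)
    have "(f has_real_derivative null_coord \<sigma> (q t) * (0 - null_control (- \<sigma>) (u t)) +
        null_control \<sigma> (u t) * (c - null_coord (- \<sigma>) (q t))) (at t within {0..T})"
      unfolding f_def using elim
      by (intro DERIV_mult' DERIV_diff DERIV_const) auto
    moreover have "null_coord \<sigma> (q t) * (0 - null_control (- \<sigma>) (u t)) = 0"
      using elim by simp
    moreover have "null_coord (- \<sigma>) (q t) \<le> c"
      unfolding c_def using mono_onD[OF causal_null_coord_mono[OF tr \<sigma>'], of t T] elim by simp
    ultimately show ?case
      using null_control_nonneg[OF _ \<sigma>] elim by simp
  qed
  then have "mono_on {0..T} f" by (rule lipschitz_AE_mono_on[OF K])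
  moreover have "f 0 = 0" "f T = 0" by (simp_all add: f_def c_def q0)
  ultimately have "f t = 0"
    using t mono_onD[of "{0..T}" f 0 t] mono_onD[of "{0..T}" f t T] by simp
  then show ?thesis by (auto simp: f_def c_def)
qed

text \<open>The integrand is the root of 4 a' b', and a b' = 0 almost everywhere. Where a is
  nonzero, b' = 0; where a = 0, it has been zero since the start, so a' = 0.\<close>

lemma zero_slack_sl_length:
  assumes tr: "trajectory causal_controls u q T" and \<sigma>: "\<sigma> \<in> {1, -1}" and q0: "q 0 = (0, 0, 0)"
    and end0: "slack \<sigma> (q T) = 0" and T: "0 < T"
  shows "sl_length u T = 0"
proof -
  \<comment> \<open>Time 0 is set aside because \<open>{0..t}\<close> has to be nondegenerate
    below.\<close>
  have "AE t in lebesgue_on {0..T}. t \<noteq> 0"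
    by (subst AE_restrict_space_iff) (auto intro: AE_completion AE_mp[OF AE_lborel_singleton[of 0]])
  with trajectory_AE_null_coord_derivative[OF tr] zero_slack_AE[OF tr \<sigma> q0 end0 T]
  have "AE t in lebesgue_on {0..T}. sqrt ((fst (u t))\<^sup>2 - (snd (u t))\<^sup>2) = 0"
  proof eventually_elim
    case (elim t)
    have "null_control \<sigma> (u t) * null_control (- \<sigma>) (u t) = 0"
    proof (cases "null_coord \<sigma> (q t) = 0")
      case True
      have Z: "null_coord \<sigma> (q s) = 0" if "s \<in> {0..t}" for s
        using mono_onD[OF causal_null_coord_mono[OF tr \<sigma>], of s t]
          causal_null_coord_nonneg[OF tr \<sigma> q0, of s] that True elim by auto
      have "((\<lambda>t. null_coord \<sigma> (q t)) has_real_derivative null_control \<sigma> (u t)) (at t within {0..T})"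
        using elim by blast
      \<comment> \<open>As a may begin to grow right after \<open>t\<close>, only its derivative
        from the left is compared with zero.\<close>
      then have D: "((\<lambda>t. null_coord \<sigma> (q t)) has_real_derivative null_control \<sigma> (u t)) (at t within {0..t})"
        by (rule DERIV_subset) (use elim in auto)
      have "null_control \<sigma> (u t) = 0"
        by (rule derivative_of_zero_on_Icc[OF _ _ D Z]) (use elim in auto)
      then show ?thesis by simp
    qed (use elim in simp)
    moreover have "(fst (u t))\<^sup>2 - (snd (u t))\<^sup>2 = 4 * (null_control \<sigma> (u t) * null_control (- \<sigma>) (u t))"
      using \<sigma> by (auto simp: null_control_def case_prod_beta power2_eq_square field_simps)
    ultimately show ?case by simp
  qed
  then show ?thesis
    unfolding sl_length_def by (rule integral_eq_zero_AE)
qed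

section \<open>The broken line traced by these trajectories\<close>

text \<open>The absolute value and the maximum put both arcs into one formula: along X1 - \<sigma>
  X2 until the corner at time \<tau>, then along X1 + \<sigma> X2. The parameter is the coordinate
  x.\<close>

definition broken_line :: "real \<Rightarrow> real \<Rightarrow> real \<Rightarrow> point" where
  "broken_line \<sigma> \<tau> t = (t, \<sigma> * (\<bar>t - \<tau>\<bar> - \<tau>), \<sigma> * \<tau> * max 0 (t - \<tau>))"

lemma broken_line_before: "t \<le> \<tau> \<Longrightarrow> broken_line \<sigma> \<tau> t = (t, - \<sigma> * t, 0)"
  by (simp add: broken_line_def)

lemma broken_line_after:
  "\<tau> \<le> t \<Longrightarrow> broken_line \<sigma> \<tau> t = (t, \<sigma> * (t - 2 * \<tau>), \<sigma> * \<tau> * (t - \<tau>))"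
  by (simp add: broken_line_def)

text \<open>With zero slack, a and b determine the point: x = a + b, y = \<sigma> (a - b), z =
  \<sigma> a b. The case a = 0 gives the first arc, b = \<tau> the second.\<close>

lemma zero_slack_eq_broken_line:
  assumes "\<sigma> \<in> {1, -1}" "slack \<sigma> p = 0" "0 \<le> null_coord \<sigma> p" "null_coord (- \<sigma>) p \<le> \<tau>"
    and "null_coord \<sigma> p = 0 \<or> null_coord (- \<sigma>) p = \<tau>"
  shows "p = broken_line \<sigma> \<tau> (fst p)"
proof -
  obtain x y z where p: "p = (x, y, z)" by (cases p)
  define a b where "a = null_coord \<sigma> p" and "b = null_coord (- \<sigma>) p"
  have xyz: "x = a + b" "y = \<sigma> * (a - b)" "z = \<sigma> * (a * b)"
    using assms(1,2) by (auto simp: a_def b_def p null_coord_def slack_def field_simps)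
  show ?thesis
  proof (cases "a = 0")
    case True
    then show ?thesis
      using assms(4)[folded b_def] unfolding p xyz by (simp add: broken_line_before)
  next
    case False
    then have "b = \<tau>" "0 \<le> a" using assms(3,5) by (simp_all add: a_def b_def)
    then show ?thesis
      unfolding p xyz by (simp add: broken_line_after)
  qed
qed

text \<open>The change of parameter is x along the curve. It is nondecreasing as the sum of the two
  null coordinates, and onto by the intermediate value theorem.\<close>

lemma zero_slack_reparametrization:
  assumes tr: "trajectory causal_controls u q T" and \<sigma>: "\<sigma> \<in> {1, -1}" and q0: "q 0 = (0, 0, 0)"
    and end0: "slack \<sigma> (q T) = 0"
  shows "reparametrization (broken_line \<sigma> (null_coord (- \<sigma>) (q T))) (fst (q T)) q T"
proof -
  have \<sigma>': "- \<sigma> \<in> {1, -1}" using \<sigma> by auto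
  have T: "0 \<le> T" using tr by (simp add: trajectory_def)
  define \<theta> where "\<theta> = (\<lambda>t. fst (q t))"
  have "\<theta> t = null_coord \<sigma> (q t) + null_coord (- \<sigma>) (q t)" for t
    by (simp add: \<theta>_def null_coord_def case_prod_beta field_simps)
  then have mono: "mono_on {0..T} \<theta>"
    using causal_null_coord_mono[OF tr \<sigma>] causal_null_coord_mono[OF tr \<sigma>']
    by (auto simp: mono_on_def intro: add_mono)
  obtain L where L: "L-lipschitz_on {0..T} \<theta>"
    using lipschitz_on_bounded_linear_compose[OF bounded_linear_fst] tr
    unfolding trajectory_def \<theta>_def by blast
  have image: "\<theta> ` {0..T} = {0..\<theta> T}"
  proof
    show "\<theta> ` {0..T} \<subseteq> {0..\<theta> T}"
      using mono_onD[OF mono, of 0] mono_onD[OF mono, of _ T] T by (auto simp: \<theta>_def q0)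
    show "{0..\<theta> T} \<subseteq> \<theta> ` {0..T}"
    proof
      fix y assume "y \<in> {0..\<theta> T}"
      then obtain x where "0 \<le> x" "x \<le> T" "\<theta> x = y"
        using IVT'[of \<theta> 0 y T] lipschitz_on_continuous_on[OF L] T by (auto simp: \<theta>_def q0)
      then show "y \<in> \<theta> ` {0..T}" by auto
    qed
  qed
  have curve: "q t = broken_line \<sigma> (null_coord (- \<sigma>) (q T)) (\<theta> t)" if t: "t \<in> {0..T}" for t
    unfolding \<theta>_def
    using zero_slack_propagates[OF tr \<sigma> q0 end0 t] causal_null_coord_nonneg[OF tr \<sigma> q0 t]
      mono_onD[OF causal_null_coord_mono[OF tr \<sigma>'], of t T] zero_slack_imp_broken[OF tr \<sigma> q0 end0 t] t
    by (intro zero_slack_eq_broken_line[OF \<sigma>]) simp_all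
  show ?thesis
    unfolding reparametrization_def
    using T mono L image curve unfolding \<theta>_def by blast
qed

section \<open>Timelike curves and achronal points\<close>

text \<open>A single point \<tau> is a null set, so the dynamics may fail there: at the corner of a
  broken line, or at a time where a control degenerates.\<close>

lemma trajectoryI:
  assumes "0 \<le> T" "\<exists>L. L-lipschitz_on {0..T} q" "u \<in> borel_measurable borel"
    and "\<And>t. t \<in> {0..T} \<Longrightarrow> t \<noteq> \<tau> \<Longrightarrow> u t \<in> U \<and>
      (q has_vector_derivative fst (u t) *\<^sub>R X1 (q t) + snd (u t) *\<^sub>R X2 (q t)) (at t within {0..T})"
  shows "trajectory U u q T"
proof -
  have "u \<in> borel_measurable (lebesgue_on {0..T})"
    using assms(3) by (intro measurable_restrict_space1 measurable_completion) simp
  moreover have "AE t in lebesgue_on {0..T}. t \<noteq> \<tau>"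
    by (subst AE_restrict_space_iff) (auto intro: AE_completion AE_mp[OF AE_lborel_singleton[of \<tau>]])
  then have "AE t in lebesgue_on {0..T}. u t \<in> U \<and>
      (q has_vector_derivative fst (u t) *\<^sub>R X1 (q t) + snd (u t) *\<^sub>R X2 (q t)) (at t within {0..T})"
    using AE_space by eventually_elim (use assms(4) in simp)
  ultimately show ?thesis
    unfolding trajectory_def using assms(1,2) by blast
qed

lemma lipschitz_on_power:
  fixes a b :: real
  shows "\<exists>K. K-lipschitz_on {a..b} (\<lambda>t. t ^ n)"
proof (induction n)
  case 0
  show ?case by (auto intro: lipschitz_on_constant)
next
  case (Suc n)
  then obtain K where "K-lipschitz_on {a..b} (\<lambda>t. t ^ n)" by blast
  then show ?case
    using lipschitz_on_compact_mult[OF lipschitz_on_id] by simp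
qed

text \<open>Witness: \<open>b = \<beta> t\<close> and \<open>a = \<alpha> ((1 - \<lambda>) t + \<lambda> t^(m+1))\<close> on \<open>[0, 1]\<close>, along which
  \<open>\<sigma> z = \<alpha> \<beta> \<lambda> m / (m + 2) t^(m+2)\<close>; the factor \<open>\<lambda> m / (m + 2)\<close> takes all values in \<open>[0, 1)\<close>.\<close>

lemma chronological_future_origin:
  assumes \<sigma>: "\<sigma> \<in> {1, -1}" and "0 < null_coord \<sigma> p" "0 < null_coord (- \<sigma>) p"
    and z: "0 \<le> \<sigma> * snd (snd p)" and sl: "0 < slack \<sigma> p"
  shows "p \<in> chronological_future (0, 0, 0)"
proof -
  define \<alpha> \<beta> c where "\<alpha> = null_coord \<sigma> p" and "\<beta> = null_coord (- \<sigma>) p"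
    and "c = \<sigma> * snd (snd p) / (\<alpha> * \<beta>)"
  have ab: "0 < \<alpha>" "0 < \<beta>" using assms by (simp_all add: \<alpha>_def \<beta>_def)
  have zc: "\<alpha> * \<beta> * c = \<sigma> * snd (snd p)" using ab by (simp add: c_def)
  have "\<alpha> * \<beta> * c < \<alpha> * \<beta>" unfolding zc using sl by (simp add: slack_def \<alpha>_def \<beta>_def)
  then have c: "0 \<le> c" "c < 1" using z ab by (simp_all add: c_def)
  \<comment> \<open>The inequality says c (m + 2) < m. It keeps \<open>l\<close>, chosen below so
    that l m / (m + 2) = c, from exceeding 1.\<close>
  obtain m where m: "2 * c < of_nat m * (1 - c)"
    using ex_less_of_nat_mult[of "1 - c" "2 * c"] c by auto
  have m0: "0 < real m" using m c by (cases m) auto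
  define l where "l = c * (real m + 2) / real m"
  have l: "0 \<le> l" "l \<le> 1" and lm: "l * real m = c * (real m + 2)"
    using c m m0 by (simp_all add: l_def field_simps)
  define A B where "A = (\<lambda>t. \<alpha> * ((1 - l) * t + l * t ^ Suc m))" and "B = (\<lambda>t. \<beta> * t)"
  define A' where "A' = (\<lambda>t. \<alpha> * ((1 - l) + l * (real (Suc m) * t ^ m)))"
  define q :: "real \<Rightarrow> point" where
    "q = (\<lambda>t. (A t + B t, \<sigma> * (A t - B t), (\<sigma> * (\<alpha> * \<beta> * c)) * t ^ (m + 2)))"
  define u :: "real \<Rightarrow> control" where "u = (\<lambda>t. (A' t + \<beta>, \<sigma> * (A' t - \<beta>)))"
  have "trajectory timelike_controls u q 1"
  \<comment> \<open>Under the bound \<open>l \<le> 1\<close> alone, \<open>A'\<close> could vanish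
    at time 0, namely for l = 1; hence the exceptional time.\<close>
  proof (rule trajectoryI[where \<tau> = 0])
    obtain K where K: "K-lipschitz_on {0..1} (\<lambda>t :: real. t ^ Suc m)"
      using lipschitz_on_power by blast
    obtain M where M: "M-lipschitz_on {0..1} (\<lambda>t :: real. t ^ (m + 2))"
      using lipschitz_on_power by blast
    have LA: "(\<bar>\<alpha>\<bar> * (\<bar>1 - l\<bar> * 1 + \<bar>l\<bar> * K))-lipschitz_on {0..1} A"
      unfolding A_def
      by (rule lipschitz_on_cmult_real lipschitz_on_add lipschitz_on_id K)+
    have LB: "(\<bar>\<beta>\<bar> * 1)-lipschitz_on {0..1} B"
      unfolding B_def by (rule lipschitz_on_cmult_real lipschitz_on_id)+
    show "\<exists>L. L-lipschitz_on {0..1} q"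
      unfolding q_def
      by (rule exI) (rule lipschitz_on_Pair[OF lipschitz_on_add[OF LA LB]
          lipschitz_on_Pair[OF lipschitz_on_cmult_real[OF lipschitz_on_diff[OF LA LB]]
            lipschitz_on_cmult_real[OF M]]])
    show "u \<in> borel_measurable borel"
      unfolding u_def A'_def by (intro borel_measurable_continuous_onI continuous_intros)
    fix t :: real assume t: "t \<in> {0..1}" "t \<noteq> 0"
    have "0 < (1 - l) + l * (real (Suc m) * t ^ m)"
    proof (cases "l = 1")
      case False
      then show ?thesis using l t by (intro add_pos_nonneg) auto
    qed (use t in simp)
    then have "0 < A' t" using ab by (simp add: A'_def)
    then have "u t \<in> timelike_controls"
      using \<sigma> ab by (auto simp: u_def timelike_controls_def abs_less_iff)
    moreover have "(q has_vector_derivative fst (u t) *\<^sub>R X1 (q t) + snd (u t) *\<^sub>R X2 (q t)) (at t within {0..1})"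
    proof -
      have "(A has_real_derivative \<alpha> * ((1 - l) * 1 + l * (real (Suc m) * t ^ (Suc m - Suc 0))))
          (at t within {0..1})"
        unfolding A_def by (intro DERIV_cmult DERIV_add DERIV_ident DERIV_pow)
      then have dA: "(A has_real_derivative A' t) (at t within {0..1})"
        by (simp add: A'_def)
      have dB: "(B has_real_derivative \<beta>) (at t within {0..1})"
        unfolding B_def by (auto intro!: derivative_eq_intros)
      have dp: "((\<lambda>t. t ^ (m + 2)) has_real_derivative real (m + 2) * t ^ (m + 1)) (at t within {0..1})"
        using DERIV_pow[of "m + 2"] by simp
      have "(q has_vector_derivative (A' t + \<beta>, \<sigma> * (A' t - \<beta>),
          (\<sigma> * (\<alpha> * \<beta> * c)) * (real (m + 2) * t ^ (m + 1)))) (at t within {0..1})"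
        unfolding q_def
        by (intro has_vector_derivative_Pair)
          (simp_all only: has_real_derivative_iff_has_vector_derivative[symmetric]
            DERIV_add[OF dA dB] DERIV_cmult[OF DERIV_diff[OF dA dB]] DERIV_cmult[OF dp])
      moreover have "(\<sigma> * (\<alpha> * \<beta> * c)) * (real (m + 2) * t ^ (m + 1)) = \<sigma> * (B t * A' t - A t * \<beta>)"
      proof -
        \<comment> \<open>The linear part of \<open>A\<close> cancels against \<open>B\<close>; by
          \<open>lm\<close>, what remains matches the derivative of the z component.\<close>
        have "B t * A' t - A t * \<beta> = \<alpha> * \<beta> * (l * real m) * t ^ (m + 1)"
          by (simp add: A_def B_def A'_def algebra_simps)
        then show ?thesis by (simp add: lm algebra_simps)
      qed
      moreover have "fst (u t) *\<^sub>R X1 (q t) + snd (u t) *\<^sub>R X2 (q t)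
          = (A' t + \<beta>, \<sigma> * (A' t - \<beta>), \<sigma> * (B t * A' t - A t * \<beta>))"
        by (simp add: u_def q_def X1_def X2_def field_simps)
      ultimately show ?thesis by (simp only:)
    qed
    ultimately show "u t \<in> timelike_controls \<and>
        (q has_vector_derivative fst (u t) *\<^sub>R X1 (q t) + snd (u t) *\<^sub>R X2 (q t)) (at t within {0..1})"
      by blast
  qed simp
  moreover have "q 0 = (0, 0, 0)" by (simp add: q_def A_def B_def)
  moreover have "q 1 = p"
    using \<sigma> by (cases p) (auto simp: q_def A_def B_def zc, auto simp: \<alpha>_def \<beta>_def null_coord_def field_simps)
  ultimately show ?thesis
    unfolding chronological_future_def by (intro CollectI exI[of _ u] exI[of _ q] exI[of _ 1]) simp
qed

text \<open>Positive slack for the sign of z would put the point into the chronological future,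
  unless a null coordinate vanishes. The positivity of \<open>null_coord \<sigma> p\<close> makes
  the last arc nontrivial.\<close>

lemma achronal_point_zero_slack:
  assumes p: "p \<in> causal_future (0, 0, 0) - chronological_future (0, 0, 0)" and "p \<noteq> (0, 0, 0)"
  obtains \<sigma> where "\<sigma> \<in> {1, -1}" "slack \<sigma> p = 0" "0 < null_coord \<sigma> p"
proof -
  obtain x y z where xyz: "p = (x, y, z)" by (cases p)
  have nn: "0 \<le> null_coord \<sigma> p" "0 \<le> slack \<sigma> p" if "\<sigma> \<in> {1, -1}" for \<sigma>
    using causal_future_bounds[OF _ that] p by auto
  show thesis
  proof (cases "null_coord 1 p * null_coord (- 1) p = 0")
    case True
    \<comment> \<open>Here the two slacks are -z and z, and both are nonnegative.\<close>
    then have "z = 0" using nn(2)[of 1] nn(2)[of "- 1"] by (auto simp: slack_def xyz)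
    then have "null_coord 1 p \<noteq> 0 \<or> null_coord (- 1) p \<noteq> 0"
      using \<open>p \<noteq> (0, 0, 0)\<close> by (auto simp: xyz null_coord_def)
    then have "0 < null_coord 1 p \<or> 0 < null_coord (- 1) p"
      using nn(1)[of 1] nn(1)[of "- 1"] by auto
    moreover have "slack 1 p = 0" "slack (- 1) p = 0"
      using True \<open>z = 0\<close> by (auto simp: slack_def xyz)
    ultimately show thesis using that by blast
  next
    case False
    then have pos: "0 < null_coord \<sigma> p" "0 < null_coord (- \<sigma>) p" if "\<sigma> \<in> {1, -1}" for \<sigma>
      using nn(1)[of 1] nn(1)[of "- 1"] that by auto
    \<comment> \<open>This sign gives the smaller of the two slacks.\<close>
    define \<sigma> :: real where "\<sigma> = (if 0 \<le> z then 1 else -1)"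
    have \<sigma>: "\<sigma> \<in> {1, -1}" "0 \<le> \<sigma> * snd (snd p)" by (auto simp: \<sigma>_def xyz)
    then have "slack \<sigma> p = 0"
      using chronological_future_origin[OF \<sigma>(1) pos(1,2)[OF \<sigma>(1)] \<sigma>(2)] p nn(2)[OF \<sigma>(1)] by force
    then show thesis using that \<sigma>(1) pos(1) by blast
  qed
qed


section \<open>The broken line as a lightlike trajectory\<close>

text \<open>Each arc is straight, since its field is constant along it. Closed half-lines include
  the corner, restrict to any arc, and give the two-sided derivative elsewhere.\<close>

lemma broken_line_derivative:
  "t \<in> {..\<tau>} \<Longrightarrow> (broken_line \<sigma> \<tau> has_vector_derivative
      X1 (broken_line \<sigma> \<tau> t) + (- \<sigma>) *\<^sub>R X2 (broken_line \<sigma> \<tau> t)) (at t within {..\<tau>})"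
  "t \<in> {\<tau>..} \<Longrightarrow> (broken_line \<sigma> \<tau> has_vector_derivative
      X1 (broken_line \<sigma> \<tau> t) + \<sigma> *\<^sub>R X2 (broken_line \<sigma> \<tau> t)) (at t within {\<tau>..})"
proof -
  assume t: "t \<in> {..\<tau>}"
  have "((\<lambda>t. (t, - \<sigma> * t, 0 :: real)) has_vector_derivative (1, - \<sigma>, 0)) (at t within {..\<tau>})"
    by (auto intro!: derivative_eq_intros)
  moreover have "X1 (broken_line \<sigma> \<tau> t) + (- \<sigma>) *\<^sub>R X2 (broken_line \<sigma> \<tau> t) = (1, - \<sigma>, 0)"
    using t by (simp add: broken_line_before X1_def X2_def)
  ultimately show "(broken_line \<sigma> \<tau> has_vector_derivative
      X1 (broken_line \<sigma> \<tau> t) + (- \<sigma>) *\<^sub>R X2 (broken_line \<sigma> \<tau> t)) (at t within {..\<tau>})"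
    using t by (simp only:) (rule has_vector_derivative_transform, auto simp: broken_line_before)
next
  assume t: "t \<in> {\<tau>..}"
  have "((\<lambda>t. (t, \<sigma> * (t - 2 * \<tau>), \<sigma> * \<tau> * (t - \<tau>))) has_vector_derivative (1, \<sigma>, \<sigma> * \<tau>))
      (at t within {\<tau>..})"
    by (auto intro!: derivative_eq_intros)
  moreover have "X1 (broken_line \<sigma> \<tau> t) + \<sigma> *\<^sub>R X2 (broken_line \<sigma> \<tau> t) = (1, \<sigma>, \<sigma> * \<tau>)"
    using t by (simp add: broken_line_after X1_def X2_def field_simps)
  ultimately show "(broken_line \<sigma> \<tau> has_vector_derivative
      X1 (broken_line \<sigma> \<tau> t) + \<sigma> *\<^sub>R X2 (broken_line \<sigma> \<tau> t)) (at t within {\<tau>..})"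
    using t by (simp only:) (rule has_vector_derivative_transform, auto simp: broken_line_after)
qed

lemma affine_imp_smooth_curve_on:
  assumes "\<And>t. t \<in> I \<Longrightarrow> q t = a + t *\<^sub>R v"
  shows "smooth_curve_on I q"
proof -
  define D where "D = (\<lambda>n :: nat. case n of 0 \<Rightarrow> (\<lambda>t. a + t *\<^sub>R v) | Suc 0 \<Rightarrow> (\<lambda>t. v) | _ \<Rightarrow> (\<lambda>t. 0))"
  have "(D n has_vector_derivative D (Suc n) t) (at t within I)" for n t
    by (auto simp: D_def split: nat.split intro!: derivative_eq_intros)
  moreover have "\<forall>t\<in>I. D 0 t = q t" using assms by (simp add: D_def)
  ultimately show ?thesis unfolding smooth_curve_on_def by blast
qed

lemma broken_line_smooth:
  "smooth_curve_on {r..\<tau>} (broken_line \<sigma> \<tau>)" "smooth_curve_on {\<tau>..s} (broken_line \<sigma> \<tau>)"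
  by (rule affine_imp_smooth_curve_on[where a = "(0, 0, 0)" and v = "(1, - \<sigma>, 0)"],
      simp add: broken_line_before)
    (rule affine_imp_smooth_curve_on[where a = "(0, - 2 * \<sigma> * \<tau>, - \<sigma> * \<tau> * \<tau>)" and v = "(1, \<sigma>, \<sigma> * \<tau>)"],
      simp add: broken_line_after algebra_simps)

lemma broken_line_generated:
  "generated_by (\<lambda>p. X1 p + (- \<sigma>) *\<^sub>R X2 p) (broken_line \<sigma> \<tau>) {r..\<tau>}"
  "generated_by (\<lambda>p. X1 p + \<sigma> *\<^sub>R X2 p) (broken_line \<sigma> \<tau>) {\<tau>..s}"
  unfolding generated_by_def
  by (rule ballI, rule has_vector_derivative_within_subset[OF broken_line_derivative(1)]; force)
    (rule ballI, rule has_vector_derivative_within_subset[OF broken_line_derivative(2)]; force)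

text \<open>The first arc lasts for the time \<tau>, so it disappears exactly when \<tau> = 0; the
  second is nontrivial because \<tau> < T.\<close>

lemma broken_line_lightlike_subarcs:
  assumes "\<sigma> \<in> {1, -1}" "0 \<le> \<tau>" "\<tau> < T"
  shows "\<exists>n\<in>{1, 2}. lightlike_subarcs n (broken_line \<sigma> \<tau>) T"
proof (cases "\<tau> = 0")
  case True
  have "lightlike_subarcs 1 (broken_line \<sigma> \<tau>) T"
    unfolding lightlike_subarcs_def
    by (rule exI[of _ "\<lambda>i. if i = 0 then 0 else T"], rule exI[of _ "\<lambda>_. \<sigma>"])
      (use assms True broken_line_smooth(2)[of \<tau> T] broken_line_generated(2)[of \<sigma> \<tau> T] in simp)
  then show ?thesis by blast
next
  case False
  have "lightlike_subarcs 2 (broken_line \<sigma> \<tau>) T"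
    unfolding lightlike_subarcs_def
    by (rule exI[of _ "\<lambda>i. if i = 0 then 0 else if i = 1 then \<tau> else T"],
        rule exI[of _ "\<lambda>i. if i = 0 then - \<sigma> else \<sigma>"])
      (use assms False broken_line_smooth broken_line_generated in \<open>auto simp: less_2_cases_iff\<close>)
  then show ?thesis by blast
qed

text \<open>At the switching time the value is that of the second arc, so for \<tau> = 0 the control
  is constant on all of \<open>{0..T}\<close>, time 0 included.\<close>

definition broken_control :: "real \<Rightarrow> real \<Rightarrow> real \<Rightarrow> control" where
  "broken_control \<sigma> \<tau> t = (1, if t < \<tau> then - \<sigma> else \<sigma>)"

lemma broken_line_trajectory:
  assumes "\<sigma> \<in> {1, -1}" "0 \<le> T"
  shows "trajectory lightlike_controls (broken_control \<sigma> \<tau>) (broken_line \<sigma> \<tau>) T"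
proof (rule trajectoryI[where \<tau> = \<tau>])
  have A: "1-lipschitz_on {0..T} (\<lambda>t. \<bar>t - \<tau>\<bar> - \<tau>)" and M: "1-lipschitz_on {0..T} (\<lambda>t. max 0 (t - \<tau>))"
    by (auto intro!: lipschitz_onI simp: dist_real_def)
  show "\<exists>L. L-lipschitz_on {0..T} (broken_line \<sigma> \<tau>)"
    unfolding broken_line_def
    by (rule exI) (rule lipschitz_on_Pair[OF lipschitz_on_id
        lipschitz_on_Pair[OF lipschitz_on_cmult_real[OF A] lipschitz_on_cmult_real[OF M]]])
  show "broken_control \<sigma> \<tau> \<in> borel_measurable borel"
    unfolding broken_control_def by measurable
  fix t assume t: "t \<in> {0..T}" "t \<noteq> \<tau>"
  have "(broken_line \<sigma> \<tau> has_vector_derivative fst (broken_control \<sigma> \<tau> t) *\<^sub>R X1 (broken_line \<sigma> \<tau> t)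
      + snd (broken_control \<sigma> \<tau> t) *\<^sub>R X2 (broken_line \<sigma> \<tau> t)) (at t)"
  proof (cases "t < \<tau>")
    case True
    then have "at t within {..\<tau>} = at t" by (intro at_within_interior) simp
    with True broken_line_derivative(1)[of t \<tau> \<sigma>] show ?thesis
      by (simp add: broken_control_def)
  next
    case False
    then have "at t within {\<tau>..} = at t" using t by (intro at_within_interior) simp
    with False broken_line_derivative(2)[of t \<tau> \<sigma>] show ?thesis
      by (simp add: broken_control_def)
  qed
  then show "broken_control \<sigma> \<tau> t \<in> lightlike_controls \<and>
      (broken_line \<sigma> \<tau> has_vector_derivative fst (broken_control \<sigma> \<tau> t) *\<^sub>R X1 (broken_line \<sigma> \<tau> t)
      + snd (broken_control \<sigma> \<tau> t) *\<^sub>R X2 (broken_line \<sigma> \<tau> t)) (at t within {0..T})"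
    using assms(1) by (auto simp: broken_control_def lightlike_controls_def intro: has_vector_derivative_at_within)
qed (use assms in simp)

lemma trajectory_controls_mono:
  "trajectory U u q T \<Longrightarrow> U \<subseteq> V \<Longrightarrow> trajectory V u q T"
  unfolding trajectory_def by (auto elim!: eventually_mono)

lemma lightlike_subset_causal: "lightlike_controls \<subseteq> causal_controls"
  by (auto simp: lightlike_controls_def causal_controls_def)

section \<open>Optimality, uniqueness up to reparametrization, and the three cases\<close>

theorem theorem8:
  fixes x1 y1 z1 :: real
  assumes "(x1, y1, z1) \<in> causal_future (0, 0, 0) - chronological_future (0, 0, 0)"
    and "(x1, y1, z1) \<noteq> (0, 0, 0)"
  shows "\<exists>u q t1.
      optimal (0, 0, 0) (x1, y1, z1) u q t1 \<and>
      (\<forall>v r s1. optimal (0, 0, 0) (x1, y1, z1) v r s1 \<longrightarrow> reparametrization q t1 r s1) \<and>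
      trajectory lightlike_controls u q t1 \<and>
      (\<exists>n\<in>{1, 2}. lightlike_subarcs n q t1) \<and>
      (z1 = 0 \<longrightarrow>
         t1 = x1 \<and>
         (\<exists>\<sigma>\<in>{1, -1}. y1 = \<sigma> * x1 \<and>
            (\<forall>t\<in>{0..t1}. u t = (1, \<sigma>) \<and> q t = (t, \<sigma> * t, 0)))) \<and>
      (z1 > 0 \<longrightarrow>
         (let \<tau>1 = (x1 - y1) / 2; \<tau>2 = (x1 + y1) / 2 in
            0 < \<tau>1 \<and> 0 < \<tau>2 \<and> t1 = \<tau>1 + \<tau>2 \<and>
            (\<forall>t\<in>{0..<\<tau>1}. u t = (1, -1)) \<and>
            (\<forall>t\<in>{0..\<tau>1}. q t = (t, -t, 0)) \<and>
            (\<forall>t\<in>{\<tau>1<..\<tau>1 + \<tau>2}. u t = (1, 1)) \<and>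
            (\<forall>t\<in>{\<tau>1..\<tau>1 + \<tau>2}. q t = (t, t - 2 * \<tau>1, \<tau>1 * (t - \<tau>1))))) \<and>
      (z1 < 0 \<longrightarrow>
         (let \<tau>1 = (x1 + y1) / 2; \<tau>2 = (x1 - y1) / 2 in
            0 < \<tau>1 \<and> 0 < \<tau>2 \<and> t1 = \<tau>1 + \<tau>2 \<and>
            (\<forall>t\<in>{0..<\<tau>1}. u t = (1, 1)) \<and>
            (\<forall>t\<in>{0..\<tau>1}. q t = (t, t, 0)) \<and>
            (\<forall>t\<in>{\<tau>1<..\<tau>1 + \<tau>2}. u t = (1, -1)) \<and>
            (\<forall>t\<in>{\<tau>1..\<tau>1 + \<tau>2}. q t = (t, 2 * \<tau>1 - t, - \<tau>1 * (t - \<tau>1)))))"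
proof -
  define p where "p = (x1, y1, z1)"
  obtain \<sigma> where \<sigma>: "\<sigma> \<in> {1, -1}" and s0: "slack \<sigma> p = 0" and "0 < null_coord \<sigma> p"
    using achronal_point_zero_slack assms unfolding p_def by blast
  define \<alpha> \<tau> where "\<alpha> = null_coord \<sigma> p" and "\<tau> = null_coord (- \<sigma>) p"
  then have a: "0 < \<alpha>" using \<open>0 < null_coord \<sigma> p\<close> by simp
  have "- \<sigma> \<in> {1, -1}" using \<sigma> by auto
  then have \<tau>: "0 \<le> \<tau>"
    unfolding \<tau>_def p_def using causal_future_bounds(1) assms(1) by blast
  have x1: "x1 = \<alpha> + \<tau>" and y1: "y1 = \<sigma> * (\<alpha> - \<tau>)"
    and z1: "z1 = \<sigma> * (\<alpha> * \<tau>)"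
    using \<sigma> s0 by (auto simp: \<alpha>_def \<tau>_def p_def null_coord_def slack_def field_simps)
  have "\<tau> < x1" using x1 a by simp
  have nonneg: "0 \<le> \<alpha> * \<tau>" using a \<tau> by simp
  define u q where "u = broken_control \<sigma> \<tau>" and "q = broken_line \<sigma> \<tau>"
  have end_point: "q 0 = (0, 0, 0)" "q x1 = p"
    using \<tau> a x1 y1 z1 by (simp_all add: q_def p_def broken_line_before broken_line_after)
  have light: "trajectory lightlike_controls u q x1"
    unfolding u_def q_def using broken_line_trajectory[OF \<sigma>] \<tau> \<open>\<tau> < x1\<close> by simp
  \<comment> \<open>Zero slack depends only on the end point \<open>p\<close>, so all competitors
    have length zero and each of them is optimal.\<close>
  have len: "sl_length v S = 0"
    if "trajectory causal_controls v r S" "r 0 = (0, 0, 0)" "r S = p" for v r S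
  proof (rule zero_slack_sl_length[OF that(1) \<sigma> that(2)])
    show "slack \<sigma> (r S) = 0" using that s0 by simp
    have "S \<noteq> 0" using that assms(2) p_def by auto
    then show "0 < S" using that(1) by (simp add: trajectory_def)
  qed
  have causal: "trajectory causal_controls u q x1"
    using trajectory_controls_mono[OF light lightlike_subset_causal] .
  have "optimal (0, 0, 0) p u q x1"
    unfolding optimal_def using causal end_point len by (metis order_refl)
  moreover have "reparametrization q x1 r s1" if "optimal (0, 0, 0) p v r s1" for v r s1
  proof -
    have "trajectory causal_controls v r s1" "r 0 = (0, 0, 0)" "r s1 = p"
      using that by (auto simp: optimal_def)
    then show ?thesis
      using zero_slack_reparametrization[of v r s1, OF _ \<sigma>] s0 by (simp add: q_def \<tau>_def p_def)
  qed
  moreover have "\<exists>n\<in>{1, 2}. lightlike_subarcs n q x1"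
    unfolding q_def using broken_line_lightlike_subarcs[OF \<sigma> \<tau> \<open>\<tau> < x1\<close>] .
  moreover have "\<exists>\<sigma>\<in>{1, -1}. y1 = \<sigma> * x1 \<and> (\<forall>t\<in>{0..x1}. u t = (1, \<sigma>) \<and> q t = (t, \<sigma> * t, 0))"
    if "z1 = 0"
  proof (rule bexI[OF _ \<sigma>])
    \<comment> \<open>Since z1 = \<sigma> \<alpha> \<tau> with \<alpha> > 0, the first arc is
      absent.\<close>
    have "\<tau> = 0" using that z1 a \<sigma> by auto
    then show "y1 = \<sigma> * x1 \<and> (\<forall>t\<in>{0..x1}. u t = (1, \<sigma>) \<and> q t = (t, \<sigma> * t, 0))"
      by (simp add: x1 y1 u_def q_def broken_control_def broken_line_after)
  qed
  moreover have "let \<tau>1 = (x1 - y1) / 2; \<tau>2 = (x1 + y1) / 2 in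
            0 < \<tau>1 \<and> 0 < \<tau>2 \<and> x1 = \<tau>1 + \<tau>2 \<and>
            (\<forall>t\<in>{0..<\<tau>1}. u t = (1, -1)) \<and>
            (\<forall>t\<in>{0..\<tau>1}. q t = (t, -t, 0)) \<and>
            (\<forall>t\<in>{\<tau>1<..\<tau>1 + \<tau>2}. u t = (1, 1)) \<and>
            (\<forall>t\<in>{\<tau>1..\<tau>1 + \<tau>2}. q t = (t, t - 2 * \<tau>1, \<tau>1 * (t - \<tau>1)))" if "z1 > 0"
  proof -
    \<comment> \<open>The sign of \<open>z1\<close> is \<sigma>, and the durations of the two arcs
      are \<tau> and \<alpha>.\<close>
    have pos: "\<sigma> = 1" "0 < \<tau>" using that \<sigma> z1 nonneg \<tau> by (auto simp: order_less_le)
    then have coords: "(x1 - y1) / 2 = \<tau>" "(x1 + y1) / 2 = \<alpha>"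
      using x1 y1 by simp_all
    show ?thesis
      unfolding Let_def coords using pos a x1
      by (simp add: u_def q_def broken_control_def broken_line_before broken_line_after)
  qed
  moreover have "let \<tau>1 = (x1 + y1) / 2; \<tau>2 = (x1 - y1) / 2 in
            0 < \<tau>1 \<and> 0 < \<tau>2 \<and> x1 = \<tau>1 + \<tau>2 \<and>
            (\<forall>t\<in>{0..<\<tau>1}. u t = (1, 1)) \<and>
            (\<forall>t\<in>{0..\<tau>1}. q t = (t, t, 0)) \<and>
            (\<forall>t\<in>{\<tau>1<..\<tau>1 + \<tau>2}. u t = (1, -1)) \<and>
            (\<forall>t\<in>{\<tau>1..\<tau>1 + \<tau>2}. q t = (t, 2 * \<tau>1 - t, - \<tau>1 * (t - \<tau>1)))" if "z1 < 0"
  proof -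
    have neg: "\<sigma> = - 1" "0 < \<tau>" using that \<sigma> z1 nonneg \<tau> by (auto simp: order_less_le)
    then have coords: "(x1 + y1) / 2 = \<tau>" "(x1 - y1) / 2 = \<alpha>"
      using x1 y1 by simp_all
    show ?thesis
      unfolding Let_def coords using neg a x1
      by (simp add: u_def q_def broken_control_def broken_line_before broken_line_after)
  qed
  ultimately show ?thesis
    using light unfolding p_def by (intro exI[of _ u] exI[of _ q] exI[of _ x1] conjI) simp_all
qed

end
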